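(* For every integer $n\ge 3$, $$\tau_3(C_n)=\begin{cases}10 & \text{if } n\in\{4,5\},\\ 9 & \text{if } n\in\{3,7,10,13\},\\ 8 & \text{otherwise.}\end{cases}$$
   Context: $C_n$ is the cycle on $n$ vertices. $[k]=\{1,\dots,k\}$ and $\binom{[k]}{t}$ is the collection of all $t$-element subsets of $[k]$. $d(v,w)$ is the distance between $v$ and $w$. For a finite simple graph $G$ and positive integers $t,k$, a $t$-tone $k$-coloring of $G$ is a function $f:V(G)\to\binom{[k]}{t}$ such that $|f(v)\cap f(w)|<d(v,w)$ for all distinct $v,w\in V(G)$. The $t$-tone chromatic number $\tau_t(G)$ is the minimum $k$ such that $G$ has a $t$-tone $k$-coloring. *)

theory Defs
  imports "Graph_Theory.Graph_Theory"
begin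

context graph
begin

text \<open>
  Unit arc weights turn the library's shortest-walk cost into the usual graph distance; it is
  infinite between different components.
\<close>

definition graph_dist :: "'a \<Rightarrow> 'a \<Rightarrow> ereal" where
  "graph_dist v w = \<mu> (\<lambda>_. 1) v w"

definition tone_coloring :: "nat \<Rightarrow> nat \<Rightarrow> ('a \<Rightarrow> nat set) \<Rightarrow> bool" where
  "tone_coloring t k f \<longleftrightarrow>
     f \<in> verts G \<rightarrow> {A. A \<subseteq> {1..k} \<and> card A = t} \<and>
     (\<forall>v\<in>verts G. \<forall>w\<in>verts G. v \<noteq> w \<longrightarrow> ereal (card (f v \<inter> f w)) < graph_dist v w)"

text \<open>
  The minimum is over a nonempty set; see \<open>ex_tone_coloring\<close>.
\<close>

definition tone_chromatic_number :: "nat \<Rightarrow> nat" where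
  "tone_chromatic_number t = (LEAST k. k \<ge> 1 \<and> (\<exists>f. tone_coloring t k f))"

lemma graph_dist_pos:
  assumes "v \<noteq> w"
  shows "0 < graph_dist v w"
proof -
  have "1 \<le> graph_dist v w"
    unfolding graph_dist_def \<mu>_def
  proof (rule INF_greatest)
    fix p assume "p \<in> {p. awalk v p w}"
    then have "awalk v p w" by (rule CollectD)
    with assms have "p \<noteq> []" by (cases p) (simp_all add: awalk_def)
    then have "1 \<le> length p" by (cases p) simp_all
    then show "1 \<le> ereal (awalk_cost (\<lambda>_. 1) p)"
      unfolding awalk_cost_def sum_list_triv one_ereal_def by simp
  qed
  with ereal_0_less_1 show ?thesis by (rule less_le_trans)
qed

lemma ex_tone_coloring: "\<exists>k\<ge>1. \<exists>f. tone_coloring t k f"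
proof -
  obtain h :: "'a \<Rightarrow> nat" where h: "inj_on h (verts G)"
    using finite_imp_inj_to_nat_seg[OF finite_verts] by blast
  obtain m where m: "\<And>v. v \<in> verts G \<Longrightarrow> h v < m"
    using finite_nat_set_iff_bounded[of "h ` verts G"] by auto
  define f where "f v = {h v * t + 1 .. h v * t + t}" for v
  have sub: "f v \<subseteq> {1..m * t + 1}" if "v \<in> verts G" for v
  proof -
    have "h v * t + t \<le> m * t"
      using mult_le_mono1[of "Suc (h v)" m t] m[OF that] by simp
    then show ?thesis unfolding f_def by auto
  qed
  have card_f: "card (f v) = t" for v
    unfolding f_def by simp
  have disj: "f v \<inter> f w = {}" if "h v < h w" for v w
    using mult_le_mono1[of "Suc (h v)" "h w" t] that unfolding f_def by auto
  have "f v \<inter> f w = {}" if "v \<in> verts G" "w \<in> verts G" "v \<noteq> w" for v w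
  proof -
    have "h v \<noteq> h w" using that inj_onD[OF h] by blast
    then consider "h v < h w" | "h w < h v" by linarith
    then show ?thesis using disj[of v w] disj[of w v] by cases (simp_all add: Int_commute)
  qed
  then have "tone_coloring t (m * t + 1) f"
    unfolding tone_coloring_def using sub
    by (simp add: graph_dist_pos zero_ereal_def[symmetric] card_f)
  then show ?thesis using le_add2 by blast
qed

end

definition cycle_graph :: "nat \<Rightarrow> nat pair_pre_digraph" where
  "cycle_graph n = \<lparr>pverts = {..<n},
     parcs = {(i, j). i < n \<and> j < n \<and> (j = (i + 1) mod n \<or> i = (j + 1) mod n)}\<rparr>"

lemma pair_graph_cycle_graph:
  assumes "n \<ge> 3"
  shows "pair_graph (cycle_graph n)"
proof
  have "parcs (cycle_graph n) \<subseteq> {..<n} \<times> {..<n}"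
    unfolding cycle_graph_def by auto
  then show "finite (parcs (cycle_graph n))"
    by (rule finite_subset) simp
  have "sym (parcs (cycle_graph n))"
    unfolding cycle_graph_def sym_def by simp blast
  then show "symmetric (with_proj (cycle_graph n))"
    by (simp add: symmetric_def)
next
  fix e assume "e \<in> parcs (cycle_graph n)"
  then have e: "fst e < n" "snd e = (fst e + 1) mod n \<or> fst e = (snd e + 1) mod n"
    unfolding cycle_graph_def by (simp_all add: case_prod_beta)
  have "(i + 1) mod n \<noteq> i" if "i < n" for i
    using assms that by (cases "i + 1 = n") simp_all
  with e show "fst e \<noteq> snd e"
    by metis
qed (simp_all add: cycle_graph_def case_prod_beta)

lemma graph_cycle_graph: "n \<ge> 3 \<Longrightarrow> graph (cycle_graph n)"
  by (rule pair_graph.pair_graphD_graph[OF pair_graph_cycle_graph])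

end

theory Submission
  imports Defs
begin

text \<open>
  A map \<open>f\<close> is a 3-tone coloring of a cycle iff, going around it, the labels of vertices \<open>d\<close> steps
  apart share fewer than \<open>d\<close> colors; for labels of size 3 only \<open>d \<le> 3\<close> matters.

  Lower bounds. The labels of three consecutive vertices of a cycle with at least four vertices
  cover at least \<open>3 + 3 + 3 - 1 = 8\<close> colors, so 8 colors are needed. On \<open>C\<^sub>3\<close>, \<open>C\<^sub>4\<close> and \<open>C\<^sub>5\<close> the
  same inclusion-exclusion bound, applied to all the vertices, gives \<open>9\<close>, \<open>12 - 2 = 10\<close> and
  \<open>15 - 5 = 10\<close> (\<open>Bonferroni_card_UN\<close>). If there are exactly 8 colors, then three consecutive
  vertices see all of them. Hence, on a cycle with \<open>3 * m + 1\<close> vertices, every color occurs at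
  least \<open>m + 1\<close> times: once at a vertex chosen to carry it, and once in each of the \<open>m\<close> blocks of
  three into which the other vertices split. Counting occurrences gives
  \<open>8 * (m + 1) \<le> 3 * (3 * m + 1)\<close>, that is \<open>m \<ge> 5\<close>, which rules out 7, 10 and 13 vertices
  (\<open>eight_colors_long_cycle\<close>).

  Upper bounds. Read a coloring as a cyclic word of labels. Cyclic words that begin with the same
  three labels can be concatenated, because the condition concerns labels at most three apart
  (\<open>closed_tone_word_append\<close>). There are 8-color words of lengths 6, 8, 9 and 11 with a common
  beginning, and these lengths generate all integers \<open>n \<ge> 6\<close> other than 7, 10 and 13. Single
  words, with 9 or 10 colors, settle 4, 5, 7, 10 and 13, and three disjoint labels color \<open>C\<^sub>3\<close>.
\<close>

section \<open>Tone colorings of a cycle\<close>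

lemma cycle_graph_simps [simp]:
  "pverts (cycle_graph n) = {..<n}"
  "parcs (cycle_graph n) =
    {(i, j). i < n \<and> j < n \<and> (j = (i + 1) mod n \<or> i = (j + 1) mod n)}"
  by (simp_all add: cycle_graph_def)

lemma (in wf_digraph) awalk_cost_unit: "awalk_cost (\<lambda>_. 1) p = real (length p)"
  by (induction p) simp_all

lemma cycle_graph_awalk_exists:
  assumes "n \<ge> 3" "v < n"
  shows "\<exists>p. pre_digraph.awalk (cycle_graph n) v p ((v + d) mod n) \<and> length p = d"
proof -
  interpret graph "cycle_graph n" by (rule graph_cycle_graph) fact
  show ?thesis
  proof (induction d)
    case 0
    show ?case using assms by (simp add: awalk_Nil_iff)
  next
    case (Suc d)
    then obtain p where p: "awalk v p ((v + d) mod n)" "length p = d" by blast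
    have "((v + d) mod n, (v + Suc d) mod n) \<in> arcs (cycle_graph n)"
      using assms by (simp add: mod_Suc_eq)
    from arc_implies_awalk[OF this]
    have "awalk ((v + d) mod n) [((v + d) mod n, (v + Suc d) mod n)] ((v + Suc d) mod n)"
      by simp
    from awalk_appendI[OF p(1) this] p(2) show ?case
      by (intro exI[of _ "p @ [((v + d) mod n, (v + Suc d) mod n)]"]) simp
  qed
qed

text \<open>
  A walk has a signed displacement \<open>s\<close>: steps in one direction count \<open>1\<close>, in the other \<open>-1\<close>.
\<close>

lemma cycle_graph_awalk_displacement:
  assumes "n \<ge> 3" "pre_digraph.awalk (cycle_graph n) v p w"
  shows "\<exists>s. \<bar>s\<bar> \<le> int (length p) \<and> int w = (int v + s) mod int n"
proof -
  interpret graph "cycle_graph n" by (rule graph_cycle_graph) fact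
  from assms(2) show ?thesis
  proof (induction p arbitrary: v)
    case Nil
    then show ?case by (intro exI[of _ 0]) (auto simp: awalk_Nil_iff simp flip: of_nat_mod)
  next
    case (Cons e p)
    then have e: "e \<in> arcs (cycle_graph n)" "v = fst e" "awalk (snd e) p w"
      by (simp_all add: awalk_Cons_iff)
    from Cons.IH[OF e(3)] obtain s
      where s: "\<bar>s\<bar> \<le> int (length p)" "int w = (int (snd e) + s) mod int n" by blast
    from e(1,2) consider "snd e = (v + 1) mod n" | "v < n" "snd e < n" "v = (snd e + 1) mod n"
      by auto
    then show ?case
    proof cases
      case 1
      then have "int (snd e) = (int v + 1) mod int n" by (simp add: of_nat_mod add.commute)
      with s(2) have "int w = (int v + (s + 1)) mod int n" by (simp add: mod_simps ac_simps)
      with s(1) show ?thesis by (intro exI[of _ "s + 1"]) simp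
    next
      case 2
      have "(int v + (s - 1)) mod int n = ((int (snd e) + 1) mod int n + (s - 1)) mod int n"
        using 2(3) by (simp add: of_nat_mod add.commute)
      also have "\<dots> = int w" using s(2) by (simp add: mod_simps)
      finally show ?thesis using s(1) by (intro exI[of _ "s - 1"]) simp
    qed
  qed
qed

text \<open>
  The distance of \<open>v\<close> and \<open>w\<close> is the least \<open>d\<close> with \<open>w = (v + d) mod n\<close> or \<open>v = (w + d) mod n\<close>.
  Imposing the condition for every \<open>d\<close>, from both ends, makes the minimum implicit.
\<close>

lemma tone_coloring_cycle_iff:
  assumes n: "n \<ge> 3"
  shows "graph.tone_coloring (cycle_graph n) t k f \<longleftrightarrow>
    (\<forall>v<n. f v \<subseteq> {1..k} \<and> card (f v) = t) \<and>
    (\<forall>v<n. \<forall>d. (v + d) mod n \<noteq> v \<longrightarrow> card (f v \<inter> f ((v + d) mod n)) < d)"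
    (is "?L \<longleftrightarrow> ?A \<and> ?B")
proof -
  interpret graph "cycle_graph n" by (rule graph_cycle_graph) fact
  have dist_le: "graph_dist v ((v + d) mod n) \<le> ereal (real d)" if v: "v < n" for v d
  proof -
    from cycle_graph_awalk_exists[OF n v, of d]
    obtain p where p: "awalk v p ((v + d) mod n)" "length p = d" by blast
    have "graph_dist v ((v + d) mod n) \<le> ereal (awalk_cost (\<lambda>_. 1) p)"
      unfolding graph_dist_def \<mu>_def using p(1) by (intro INF_lower) simp
    then show ?thesis using p(2) by (simp add: awalk_cost_unit)
  qed
  have walk: "card (f v \<inter> f w) < length p"
    if B: ?B and p: "awalk v p w" and vw: "v \<noteq> w" for v w p
  proof -
    have "v < n" "w < n" using p awalk_hd_in_verts awalk_last_in_verts by fastforce+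
    obtain s where s: "\<bar>s\<bar> \<le> int (length p)" "int w = (int v + s) mod int n"
      using cycle_graph_awalk_displacement[OF n p] by blast
    show ?thesis
    proof (cases "s \<ge> 0")
      case True
      then have "int w = int ((v + nat s) mod n)" using s(2) by (simp add: of_nat_mod)
      then have "w = (v + nat s) mod n" by linarith
      with B \<open>v < n\<close> vw have "card (f v \<inter> f w) < nat s" by metis
      with s(1) True show ?thesis by linarith
    next
      case False
      have "int ((w + nat (- s)) mod n) = ((int v + s) mod int n - s) mod int n"
        using s(2) False by (simp add: of_nat_mod)
      also have "\<dots> = int v" using \<open>v < n\<close> by (simp add: mod_simps)
      finally have "v = (w + nat (- s)) mod n" by linarith
      with B \<open>w < n\<close> vw have "card (f w \<inter> f v) < nat (- s)" by metis
      with s(1) False show ?thesis by (simp add: Int_commute)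
    qed
  qed
  show ?thesis
  proof
    assume L: ?L
    have ?B
    proof (intro allI impI)
      fix v d assume v: "v < n" and ne: "(v + d) mod n \<noteq> v"
      have "ereal (card (f v \<inter> f ((v + d) mod n))) < graph_dist v ((v + d) mod n)"
        using L v ne unfolding tone_coloring_def by auto
      also note dist_le[OF v]
      finally show "card (f v \<inter> f ((v + d) mod n)) < d" by simp
    qed
    moreover have ?A using L unfolding tone_coloring_def by (auto simp: Pi_iff)
    ultimately show "?A \<and> ?B" by blast
  next
    assume AB: "?A \<and> ?B"
    have "ereal (card (f v \<inter> f w)) < graph_dist v w" if "v \<noteq> w" for v w
    proof -
      have "ereal (real (card (f v \<inter> f w) + 1)) \<le> graph_dist v w"
        unfolding graph_dist_def \<mu>_def
      proof (rule INF_greatest)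
        fix p assume "p \<in> {p. awalk v p w}"
        then have "card (f v \<inter> f w) < length p" using walk AB that by blast
        then show "ereal (real (card (f v \<inter> f w) + 1)) \<le> ereal (awalk_cost (\<lambda>_. 1) p)"
          by (simp add: awalk_cost_unit)
      qed
      then show ?thesis by (rule less_le_trans[rotated]) simp
    qed
    then show ?L using AB unfolding tone_coloring_def by auto
  qed
qed

lemma tone_coloring_cycleD:
  assumes "n \<ge> 3" "graph.tone_coloring (cycle_graph n) t k f" "v < n"
  shows "f v \<subseteq> {1..k}" "card (f v) = t" "finite (f v)"
    and "\<And>d. (v + d) mod n \<noteq> v \<Longrightarrow> card (f v \<inter> f ((v + d) mod n)) < d"
  using assms tone_coloring_cycle_iff[of n t k f] by (auto intro: finite_subset)

lemma tone_coloring_cycle_mono: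
  assumes "n \<ge> 3" "graph.tone_coloring (cycle_graph n) t k f" "k \<le> k'"
  shows "graph.tone_coloring (cycle_graph n) t k' f"
  using assms(1,2) atLeastatMost_subset_iff[of 1 k 1 k'] assms(3)
  unfolding tone_coloring_cycle_iff[OF assms(1)] by (meson le_refl subset_trans)


section \<open>Lower bounds\<close>

lemma Bonferroni_card_UN:
  fixes A :: "nat \<Rightarrow> 'a set"
  assumes "\<And>i. i < m \<Longrightarrow> finite (A i)"
  shows "(\<Sum>i<m. card (A i)) \<le> card (\<Union>i<m. A i) + (\<Sum>j<m. \<Sum>i<j. card (A i \<inter> A j))"
  using assms
proof (induction m)
  case 0
  show ?case by simp
next
  case (Suc m)
  let ?U = "\<Union>i<m. A i"
  have fin: "finite ?U" "finite (A m)" using Suc.prems by auto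
  have "card (?U \<inter> A m) = card (\<Union>i<m. A i \<inter> A m)" by (simp only: UN_simps)
  also have "\<dots> \<le> (\<Sum>i<m. card (A i \<inter> A m))" by (rule card_UN_le) simp
  finally have "card ?U + card (A m) \<le> card (?U \<union> A m) + (\<Sum>i<m. card (A i \<inter> A m))"
    using card_Un_Int[OF fin] by linarith
  moreover have "(\<Union>i<Suc m. A i) = ?U \<union> A m" by (auto simp: lessThan_Suc)
  ultimately show ?case using Suc by simp
qed

lemma add_mod_neq:
  fixes v d n :: nat
  assumes "v < n" "0 < d" "d < n"
  shows "(v + d) mod n \<noteq> v"
  using assms by (cases "v + d < n") (simp_all add: le_mod_geq)

lemma consecutive_labels_cover:
  assumes n: "n \<ge> 4" and f: "graph.tone_coloring (cycle_graph n) 3 k f" and v: "v < n"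
  shows "8 \<le> card (f v \<union> f ((v + 1) mod n) \<union> f ((v + 2) mod n))"
proof -
  let ?w = "\<lambda>i. (v + i) mod n"
  have n3: "n \<ge> 3" using n by simp
  note D = tone_coloring_cycleD[OF n3 f]
  have less: "?w i < n" for i using n by simp
  have step: "card (f (?w i) \<inter> f (?w (i + d))) < d" if "0 < d" "d < n" for i d
  proof -
    have "(?w i + d) mod n \<noteq> ?w i" by (rule add_mod_neq[OF less that])
    from D(4)[OF less this] show ?thesis by (simp add: mod_simps ac_simps)
  qed
  have "(\<Sum>i<3. card (f (?w i))) \<le>
      card (\<Union>i<3. f (?w i)) + (\<Sum>j<3. \<Sum>i<j. card (f (?w i) \<inter> f (?w j)))"
    by (intro Bonferroni_card_UN D(3)[OF less])
  moreover have "(\<Union>i<3. f (?w i)) = f v \<union> f (?w 1) \<union> f (?w 2)"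
    using v by (simp add: lessThan_nat_numeral lessThan_Suc Un_ac)
  moreover have "card (f (?w 0) \<inter> f (?w 1)) < 1" "card (f (?w 1) \<inter> f (?w 2)) < 1"
    "card (f (?w 0) \<inter> f (?w 2)) < 2"
    using step[of 1 0] step[of 1 1] step[of 2 0] n by simp_all
  ultimately show ?thesis
    using D(2)[OF less] by (simp add: lessThan_nat_numeral lessThan_Suc)
qed

lemma tone3_cycle_ge_8:
  assumes n: "n \<ge> 4" and f: "graph.tone_coloring (cycle_graph n) 3 k f"
  shows "8 \<le> k"
proof -
  have sub: "f ((0 + i) mod n) \<subseteq> {1..k}" for i
    using tone_coloring_cycleD(1)[OF _ f] n by simp
  have "8 \<le> card (f 0 \<union> f ((0 + 1) mod n) \<union> f ((0 + 2) mod n))"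
    using consecutive_labels_cover[OF n f, of 0] n by simp
  also have "\<dots> \<le> card {1..k}" using sub[of 0] sub[of 1] sub[of 2] by (intro card_mono) auto
  finally show ?thesis by simp
qed

text \<open>
  All vertices together: \<open>e i j\<close> bounds the number of colors shared by the vertices \<open>i < j\<close>.
\<close>

lemma tone_cycle_ge:
  assumes n: "n \<ge> 3" and f: "graph.tone_coloring (cycle_graph n) t k f"
    and e: "\<And>i j. i < j \<Longrightarrow> j < n \<Longrightarrow> card (f i \<inter> f j) \<le> e i j"
  shows "n * t \<le> k + (\<Sum>j<n. \<Sum>i<j. e i j)"
proof -
  note D = tone_coloring_cycleD[OF n f]
  have "n * t = (\<Sum>i<n. card (f i))" using D(2) by simp
  also have "\<dots> \<le> card (\<Union>i<n. f i) + (\<Sum>j<n. \<Sum>i<j. card (f i \<inter> f j))"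
    by (intro Bonferroni_card_UN D(3))
  also have "card (\<Union>i<n. f i) \<le> card {1..k}" using D(1) by (intro card_mono) auto
  also have "(\<Sum>j<n. \<Sum>i<j. card (f i \<inter> f j)) \<le> (\<Sum>j<n. \<Sum>i<j. e i j)"
    using e by (intro sum_mono) simp
  finally show ?thesis by simp
qed

lemma tone3_cycle3_ge_9:
  assumes "graph.tone_coloring (cycle_graph 3) 3 k f"
  shows "9 \<le> k"
proof -
  have "card (f i \<inter> f j) \<le> 0" if "i < j" "j < 3" for i j
  proof -
    from that consider "j = Suc i" | "i = 0" "j = 2" by linarith
    then show ?thesis
      using tone_coloring_cycleD(4)[OF _ assms, of i 1] tone_coloring_cycleD(4)[OF _ assms, of j 1] that
      by cases (simp_all add: Int_commute)
  qed
  from tone_cycle_ge[OF _ assms this] show ?thesis by simp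
qed

text \<open>
  In a cycle with at most five vertices, distinct vertices are at distance at most 2. The
  shared colors therefore number at most 2 on \<open>C\<^sub>4\<close>, which has two pairs of opposite vertices, and
  at most 5 on \<open>C\<^sub>5\<close>, which has five pairs of nonadjacent vertices.
\<close>

lemma tone3_cycle45_ge_10:
  assumes n: "n \<in> {4, 5}" and f: "graph.tone_coloring (cycle_graph n) 3 k f"
  shows "10 \<le> k"
proof -
  let ?e = "\<lambda>i j. if j = i + 1 \<or> i + n = j + 1 then 0 else 1 :: nat"
  have n3: "n \<ge> 3" using n by auto
  note D = tone_coloring_cycleD(4)[OF n3 f]
  have "card (f i \<inter> f j) \<le> ?e i j" if "i < j" "j < n" for i j
  proof -
    from that n consider "j = i + 1" | "i + n = j + 1" | "j = i + 2" | "i + n = j + 2"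
      by fastforce
    then show ?thesis
    proof cases
      case 1
      then show ?thesis using D[of i 1] that by simp
    next
      case 2
      then have "(j + 1) mod n = i" using that by (simp add: le_mod_geq)
      then show ?thesis using D[of j 1] that 2 by (simp add: Int_commute)
    next
      case 3
      then show ?thesis using D[of i 2] that n by auto
    next
      case 4
      then have "(j + 2) mod n = i" using that by (simp add: le_mod_geq)
      then show ?thesis using D[of j 2] that 4 n by (auto simp: Int_commute)
    qed
  qed
  from tone_cycle_ge[OF n3 f this] have "n * 3 \<le> k + (\<Sum>j<n. \<Sum>i<j. ?e i j)" by simp
  with n show ?thesis
    by (elim insertE emptyE) (simp_all add: lessThan_nat_numeral lessThan_Suc)
qed

text \<open>
  One occurrence at 0, and one in each of the blocks \<open>{3 * j + 1..3 * j + 3}\<close> for \<open>j < m\<close>.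
\<close>

lemma card_blocks_of_three:
  fixes P :: "nat \<Rightarrow> bool"
  assumes "P 0" and "\<And>i. P i \<or> P (i + 1) \<or> P (i + 2)"
  shows "m + 1 \<le> card {i. i < 3 * m + 1 \<and> P i}"
proof (induction m)
  case 0
  have "{i. i < 3 * 0 + 1 \<and> P i} = {0}" using assms(1) by auto
  then show ?case by simp
next
  case (Suc m)
  let ?S = "\<lambda>m. {i. i < 3 * m + 1 \<and> P i}"
  have "\<exists>i\<in>{3 * m + 1..<3 * Suc m + 1}. P i"
    using assms(2)[of "3 * m + 1"] by (elim disjE) (auto intro: bexI[rotated])
  then obtain i where i: "3 * m + 1 \<le> i" "i < 3 * Suc m + 1" "P i" by auto
  have "m + 1 < card (insert i (?S m))" using Suc i(1) by simp
  also have "\<dots> \<le> card (?S (Suc m))" using i by (intro card_mono) auto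
  finally show ?case by simp
qed

lemma card_rotate:
  fixes v n :: nat
  assumes "v < n"
  shows "card {i. i < n \<and> P ((v + i) mod n)} = card {i. i < n \<and> P i}"
proof -
  let ?g = "\<lambda>i. (v + i) mod n"
  have inj: "inj_on ?g {..<n}"
  proof (rule inj_onI)
    fix i j assume "i \<in> {..<n}" "j \<in> {..<n}" "(v + i) mod n = (v + j) mod n"
    then show "i = j" using assms
      by (cases "v + i < n"; cases "v + j < n") (simp_all add: le_mod_geq)
  qed
  then have "?g ` {..<n} = {..<n}"
    by (rule endo_inj_surj[rotated 2]) (use assms in auto)
  then have "{i. i < n \<and> P i} = {i \<in> ?g ` {..<n}. P i}" by simp
  also have "\<dots> = ?g ` {i. i < n \<and> P (?g i)}" by blast
  finally have "card {i. i < n \<and> P i} = card (?g ` {i. i < n \<and> P (?g i)})" by simp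
  also have "\<dots> = card {i. i < n \<and> P (?g i)}"
    by (rule card_image) (rule inj_on_subset[OF inj], auto)
  finally show ?thesis by simp
qed

lemma eight_colors_long_cycle:
  assumes f: "graph.tone_coloring (cycle_graph (3 * m + 1)) 3 8 f" and m: "m \<ge> 1"
  shows "m \<ge> 5"
proof -
  define n where "n = 3 * m + 1"
  have n: "n \<ge> 4" "n \<ge> 3" using m by (simp_all add: n_def)
  note f = f[folded n_def]
  note D = tone_coloring_cycleD[OF n(2) f]
  have cover: "c \<in> f v \<union> f ((v + 1) mod n) \<union> f ((v + 2) mod n)"
    if c: "c \<in> {1..8}" and v: "v < n" for c v
  proof -
    have "f v \<union> f ((v + 1) mod n) \<union> f ((v + 2) mod n) \<subseteq> {1..8}"
      using D(1)[OF v] D(1)[of "(v + 1) mod n"] D(1)[of "(v + 2) mod n"] n by simp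
    then have "f v \<union> f ((v + 1) mod n) \<union> f ((v + 2) mod n) = {1..8}"
      using consecutive_labels_cover[OF n(1) f v] by (intro card_seteq) auto
    with c show ?thesis by simp
  qed
  \<comment> \<open>The vertices are counted from one that carries the color, so that it comes first.\<close>
  have often: "m + 1 \<le> card {i \<in> {..<n}. c \<in> f i}" if c: "c \<in> {1..8}" for c
  proof -
    obtain v where v: "v < n" "c \<in> f v"
      using cover[OF c, of 0] n by (metis UnE less_le_trans mod_less_divisor zero_less_numeral)
    have "c \<in> f ((v + i) mod n) \<or> c \<in> f ((v + (i + 1)) mod n) \<or> c \<in> f ((v + (i + 2)) mod n)" for i
      using cover[OF c, of "(v + i) mod n"] n by (simp add: mod_simps ac_simps)
    from card_blocks_of_three[of "\<lambda>i. c \<in> f ((v + i) mod n)", OF _ this]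
    have "m + 1 \<le> card {i. i < n \<and> c \<in> f ((v + i) mod n)}"
      using v by (simp add: n_def)
    also have "\<dots> = card {i. i < n \<and> c \<in> f i}" by (rule card_rotate) fact
    finally show ?thesis by simp
  qed
  have "8 * (m + 1) \<le> (\<Sum>c\<in>{1..8}. card {i \<in> {..<n}. c \<in> f i})"
    using sum_bounded_below[of "{1..8::nat}" "m + 1", OF often] by simp
  also have "\<dots> = (\<Sum>i<n. 3)"
  proof (rule sum_multicount_gen)
    show "\<forall>i\<in>{..<n}. card {c \<in> {1..8}. c \<in> f i} = 3"
    proof
      fix i assume "i \<in> {..<n}"
      then have "{c \<in> {1..8}. c \<in> f i} = f i" "card (f i) = 3" using D(1,2)[of i] by auto
      then show "card {c \<in> {1..8}. c \<in> f i} = 3" by simp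
    qed
  qed auto
  finally show ?thesis by (simp add: n_def)
qed


section \<open>Words of labels\<close>

text \<open>
  A word over the \<open>t\<close>-subsets of \<open>{1..k}\<close> such that labels \<open>d \<le> t\<close> places apart share fewer than
  \<open>d\<close> colors; the index \<open>j\<close> below is \<open>d - 1\<close>.
\<close>

primrec tone_word :: "nat \<Rightarrow> nat \<Rightarrow> nat set list \<Rightarrow> bool" where
  "tone_word t k [] \<longleftrightarrow> True"
| "tone_word t k (A # ws) \<longleftrightarrow> A \<subseteq> {1..k} \<and> card A = t \<and>
     (\<forall>j < min t (length ws). card (A \<inter> ws ! j) \<le> j) \<and> tone_word t k ws"

lemma tone_word_nthD:
  assumes "tone_word t k ws" "i + Suc d < length ws" "d < t"
  shows "card (ws ! i \<inter> ws ! (i + Suc d)) \<le> d"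
  using assms
proof (induction ws arbitrary: i)
  case (Cons A ws)
  then show ?case by (cases i) auto
qed simp

lemma tone_word_setD: "tone_word t k ws \<Longrightarrow> A \<in> set ws \<Longrightarrow> A \<subseteq> {1..k} \<and> card A = t"
  by (induction ws) auto

lemma tone_word_overlap:
  assumes "tone_word t k (us @ xs)" "tone_word t k (xs @ vs)" "length xs = t"
  shows "tone_word t k (us @ xs @ vs)"
  using assms
proof (induction us)
  case (Cons A us)
  have "(us @ xs) ! j = (us @ xs @ vs) ! j" if "j < t" for j
    using that Cons.prems(3) nth_append[of "us @ xs" vs j] by simp
  with Cons show ?case by auto
qed simp

text \<open>
  A cyclic word \<open>ws\<close> beginning with \<open>xs\<close>, cut open: the initial \<open>t\<close> labels \<open>xs\<close> are repeated at
  the end to express the conditions across the cut.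
\<close>

definition closed_tone_word :: "nat \<Rightarrow> nat \<Rightarrow> nat set list \<Rightarrow> nat set list \<Rightarrow> bool" where
  "closed_tone_word t k xs ws \<longleftrightarrow>
     length xs = t \<and> t < length ws \<and> take t ws = xs \<and> tone_word t k (ws @ xs)"

lemma closed_tone_word_append:
  assumes u: "closed_tone_word t k xs us" and v: "closed_tone_word t k xs vs"
  shows "closed_tone_word t k xs (us @ vs)"
proof -
  have vs: "vs = xs @ drop t vs" using v by (metis append_take_drop_id closed_tone_word_def)
  have "tone_word t k (us @ xs @ (drop t vs @ xs))"
  proof (rule tone_word_overlap)
    show "tone_word t k (us @ xs)" using u by (simp add: closed_tone_word_def)
    show "tone_word t k (xs @ drop t vs @ xs)"
      using v vs by (metis append_assoc closed_tone_word_def)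
    show "length xs = t" using u by (simp add: closed_tone_word_def)
  qed
  then have "tone_word t k ((us @ vs) @ xs)" using vs by (metis append_assoc)
  with u show ?thesis by (simp add: closed_tone_word_def)
qed

lemma closed_tone_word_imp_coloring:
  assumes w: "closed_tone_word t k xs ws" and n: "length ws \<ge> 3"
  shows "graph.tone_coloring (cycle_graph (length ws)) t k (\<lambda>v. ws ! v)"
  unfolding tone_coloring_cycle_iff[OF n]
proof (intro conjI allI impI)
  let ?n = "length ws"
  have w': "tone_word t k (ws @ xs)" "t < ?n" "xs = take t ws"
    using w by (simp_all add: closed_tone_word_def)
  fix v assume v: "v < ?n"
  then have "ws ! v \<in> set (ws @ xs)" by simp
  from tone_word_setD[OF w'(1) this] show sz: "ws ! v \<subseteq> {1..k}" "card (ws ! v) = t" by simp_all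
  fix d assume ne: "(v + d) mod ?n \<noteq> v"
  show "card (ws ! v \<inter> ws ! ((v + d) mod ?n)) < d"
  proof (cases "d \<le> t")
    case True
    from ne v obtain d' where d: "d = Suc d'" by (cases d) auto
    have "(ws @ xs) ! (v + d) = ws ! ((v + d) mod ?n)"
      using v w' True by (cases "v + d < ?n") (simp_all add: nth_append le_mod_geq)
    then show ?thesis
      using tone_word_nthD[OF w'(1), of v d'] v w' True d by (simp add: nth_append)
  next
    case False
    have "card (ws ! v \<inter> ws ! ((v + d) mod ?n)) \<le> card (ws ! v)"
      using sz by (intro card_mono) (auto intro: finite_subset)
    with sz False show ?thesis by simp
  qed
qed


section \<open>Colorings of all lengths\<close>

text \<open>
  The recursion of \<open>tone_word\<close> for \<open>t = 3\<close>, with the bounded quantifier expanded.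
\<close>

lemma tone_word_3_simps:
  "tone_word 3 k (A # B # C # D # ws) \<longleftrightarrow> A \<subseteq> {1..k} \<and> card A = 3 \<and>
     card (A \<inter> B) \<le> 0 \<and> card (A \<inter> C) \<le> 1 \<and> card (A \<inter> D) \<le> 2 \<and> tone_word 3 k (B # C # D # ws)"
  "tone_word 3 k [A, B, C] \<longleftrightarrow> A \<subseteq> {1..k} \<and> card A = 3 \<and>
     card (A \<inter> B) \<le> 0 \<and> card (A \<inter> C) \<le> 1 \<and> tone_word 3 k [B, C]"
  "tone_word 3 k [A, B] \<longleftrightarrow> A \<subseteq> {1..k} \<and> card A = 3 \<and> card (A \<inter> B) \<le> 0 \<and> tone_word 3 k [B]"
  "tone_word 3 k [A] \<longleftrightarrow> A \<subseteq> {1..k} \<and> card A = 3"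
  by (simp_all add: All_less_Suc2 numeral_3_eq_3 numeral_2_eq_2 del: tone_word.simps(2))
    (simp_all add: All_less_Suc2 numeral_3_eq_3 numeral_2_eq_2)

text \<open>
  In a cyclic 8-color word every label consists of the two colors missing from the two labels before it
  and of one color of the label two places before. Hence, up to renaming colors, every such word
  begins with \<open>xs\<close>, and asking for a common beginning loses nothing.
\<close>

lemma closed_tone_words:
  defines "xs \<equiv> [{1,2,3}, {4,5,6}, {1,7,8}]"
  shows
    "closed_tone_word 3 8 xs [{1,2,3}, {4,5,6}, {1,7,8}, {2,3,4}, {1,5,6}, {4,7,8}]"
    "closed_tone_word 3 8 xs
      [{1,2,3}, {4,5,6}, {1,7,8}, {2,3,4}, {5,6,7}, {1,2,8}, {3,4,5}, {6,7,8}]"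
    "closed_tone_word 3 8 xs
      [{1,2,3}, {4,5,6}, {1,7,8}, {2,3,4}, {1,5,6}, {2,7,8}, {1,3,4}, {2,5,6}, {4,7,8}]"
    "closed_tone_word 3 8 xs
      [{1,2,3}, {4,5,6}, {1,7,8}, {2,3,4}, {1,5,6}, {2,7,8}, {1,3,4}, {5,6,7}, {1,2,8}, {3,4,5},
       {6,7,8}]"
    "closed_tone_word 3 9 xs
      [{1,2,3}, {4,5,6}, {1,7,8}, {2,3,4}, {1,5,9}, {2,6,7}, {4,8,9}]"
    "closed_tone_word 3 9 xs
      [{1,2,3}, {4,5,6}, {1,7,8}, {2,3,4}, {1,5,6}, {2,7,8}, {1,3,4}, {2,5,9}, {1,6,7}, {4,8,9}]"
    "closed_tone_word 3 9 xs
      [{1,2,3}, {4,5,6}, {1,7,8}, {2,3,4}, {1,5,6}, {2,7,8}, {1,3,4}, {2,5,6}, {1,7,8}, {2,3,4},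
       {1,5,9}, {2,6,7}, {4,8,9}]"
    "closed_tone_word 3 10 xs [{1,2,3}, {4,5,6}, {1,7,8}, {4,9,10}]"
    "closed_tone_word 3 10 xs [{1,2,3}, {4,5,6}, {1,7,8}, {2,4,9}, {5,7,10}]"
  unfolding closed_tone_word_def xs_def
  by (simp_all add: tone_word_3_simps del: tone_word.simps(2))

text \<open>
  The numbers \<open>6, 8, 9, 11, 8 + 8, 8 + 11\<close> represent all residues modulo 6, and subtracting 6 from
  any other admissible number again gives an admissible one.
\<close>

lemma closed_tone_word_8_exists:
  assumes "n \<ge> 6" "n \<notin> {7, 10, 13}"
  shows "\<exists>ws. closed_tone_word 3 8 [{1,2,3}, {4,5,6}, {1,7,8}] ws \<and> length ws = n"
    (is "\<exists>ws. closed_tone_word 3 8 ?xs ws \<and> length ws = n")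
  using assms
proof (induction n rule: less_induct)
  case (less n)
  let ?P = "\<lambda>n. \<exists>ws. closed_tone_word 3 8 ?xs ws \<and> length ws = n"
  have add: "?P (i + j)" if "?P i" "?P j" for i j
  proof -
    from that obtain us vs where
      "closed_tone_word 3 8 ?xs us" "length us = i" "closed_tone_word 3 8 ?xs vs" "length vs = j"
      by blast
    then show ?thesis
      using closed_tone_word_append by (intro exI[of _ "us @ vs"]) simp
  qed
  have base: "?P 6" "?P 8" "?P 9" "?P 11"
    using closed_tone_words(1-4) by (force intro: exI)+
  have "n \<in> {6, 8, 9, 11} \<or> n = 8 + 8 \<or> n = 8 + 11 \<or>
      n - 6 \<ge> 6 \<and> n - 6 \<notin> {7, 10, 13} \<and> n = 6 + (n - 6)"
    using less.prems unfolding insert_iff empty_iff by presburger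
  then consider "n \<in> {6, 8, 9, 11}" | "n = 8 + 8" | "n = 8 + 11"
    | "n - 6 \<ge> 6" "n - 6 \<notin> {7, 10, 13}" "n = 6 + (n - 6)"
    by blast
  then show ?case
  proof cases
    case 1
    then show ?thesis using base by auto
  next
    case 2
    then show ?thesis using add[OF base(2) base(2)] by simp
  next
    case 3
    then show ?thesis using add[OF base(2) base(4)] by simp
  next
    case 4
    then show ?thesis using add[OF base(1) less.IH[of "n - 6"]] by simp
  qed
qed

lemma tone_coloring_cycle3: "\<exists>f. graph.tone_coloring (cycle_graph 3) 3 9 f"
proof (intro exI)
  let ?f = "\<lambda>v. {3 * v + 1..3 * v + 3}"
  have "?f v \<inter> ?f w = {}" if "v \<noteq> w" for v w :: nat using that by auto
  then have "card (?f v \<inter> ?f ((v + d) mod 3)) < d" if "(v + d) mod 3 \<noteq> v" "v < 3" for v d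
    using that by (cases d) (simp_all del: atLeastatMost_subset_iff)
  then show "graph.tone_coloring (cycle_graph 3) 3 9 ?f"
    by (subst tone_coloring_cycle_iff) auto
qed

lemma tone_chromatic_number_cycleI:
  assumes n: "n \<ge> 3" and "K \<ge> 1" and "\<exists>f. graph.tone_coloring (cycle_graph n) t K f"
    and "\<And>k f. graph.tone_coloring (cycle_graph n) t k f \<Longrightarrow> K \<le> k"
  shows "graph.tone_chromatic_number (cycle_graph n) t = K"
  unfolding graph.tone_chromatic_number_def[OF graph_cycle_graph[OF n]]
  using assms(2-) by (intro Least_equality) auto

theorem theorem4p2:
  fixes n :: nat
  assumes "n \<ge> 3"
  shows "graph.tone_chromatic_number (cycle_graph n) 3 =
    (if n \<in> {4, 5} then 10 else if n \<in> {3, 7, 10, 13} then 9 else 8)"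
proof -
  have colorable: "\<exists>f. graph.tone_coloring (cycle_graph n) 3 k f"
    if "closed_tone_word 3 k xs ws" "length ws = n" for k xs ws
    using closed_tone_word_imp_coloring[OF that(1)] that(2) assms by auto
  consider "n = 3" | "n \<in> {4, 5}" | "n \<in> {7, 10, 13}" | "n \<ge> 6" "n \<notin> {7, 10, 13}"
    using assms by fastforce
  then show ?thesis
  proof cases
    case 1
    then show ?thesis
      using tone_chromatic_number_cycleI[of 3 9 3] tone_coloring_cycle3 tone3_cycle3_ge_9 by simp
  next
    case 2
    have "\<exists>f. graph.tone_coloring (cycle_graph n) 3 10 f"
      using 2 closed_tone_words(8,9)[THEN colorable] by (elim insertE emptyE) simp_all
    then have "graph.tone_chromatic_number (cycle_graph n) 3 = 10"
      using tone3_cycle45_ge_10[OF 2] by (intro tone_chromatic_number_cycleI assms) auto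
    with 2 show ?thesis by auto
  next
    case 3
    have "9 \<le> k" if "graph.tone_coloring (cycle_graph n) 3 k f" for k f
    proof (rule ccontr)
      assume "\<not> 9 \<le> k"
      then have "graph.tone_coloring (cycle_graph n) 3 8 f"
        by (intro tone_coloring_cycle_mono[OF assms that]) simp
      moreover from 3 obtain m where "n = 3 * m + 1" "1 \<le> m" "m < 5"
        by (elim insertE emptyE) (auto intro: that[of 2] that[of 3] that[of 4])
      ultimately show False using eight_colors_long_cycle by force
    qed
    moreover have "\<exists>f. graph.tone_coloring (cycle_graph n) 3 9 f"
      using 3 closed_tone_words(5-7)[THEN colorable] by (elim insertE emptyE) simp_all
    ultimately have "graph.tone_chromatic_number (cycle_graph n) 3 = 9"
      by (intro tone_chromatic_number_cycleI assms) auto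
    with 3 show ?thesis by auto
  next
    case 4
    have "\<exists>f. graph.tone_coloring (cycle_graph n) 3 8 f"
      using closed_tone_word_8_exists[OF 4] colorable by blast
    then have "graph.tone_chromatic_number (cycle_graph n) 3 = 8"
      using tone3_cycle_ge_8[of n] 4(1) by (intro tone_chromatic_number_cycleI assms) auto
    with 4 show ?thesis by auto
  qed
qed

end
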